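(* Let $V$ be a finite dimensional vector space over a field $\Bbbk$ of characteristic zero, let $\sigma:V\to V$ be a linear bijection, and let $w\in V^{\otimes d}$ ($d\ge2$) be a twisted superpotential with respect to $\sigma$. Define $\widehat{w}\in(V\oplus\Bbbk z)^{\otimes d+1}$ by $$\widehat{w}=\sum_{i=0}^d(-1)^i\tau_{d+1}^i(1\otimes\sigma^{\otimes i}\otimes1^{\otimes d-i})(z\otimes w).$$ Then $\widehat{w}$ is a superpotential of degree $d+1$.
   Context: For a vector space $W$ let $\tau:W\otimes W\to W\otimes W$ be the flip. For $m\ge2$ set $\tau_m^0=1^{\otimes m}$ and $\tau_m^k=(1^{\otimes k-1}\otimes\tau\otimes1^{\otimes m-k-1})\tau_m^{k-1}:W^{\otimes m}\to W^{\otimes m}$ for $1\le k\le m-1$. For a linear bijection $\sigma:W\to W$, an element $u\in W^{\otimes m}$ is a twisted superpotential of degree $m$ with respect to $\sigma$ if $u=(-1)^{m-1}\tau_m^{m-1}\circ(\sigma\otimes1^{\otimes m-1})(u)$; if $\sigma$ is the identity, $u$ is called a superpotential. In the formula for $\widehat w$, $z$ is a new indeterminate, $W=V\oplus\Bbbk z$, and $\sigma^{\otimes i}\otimes 1^{\otimes d-i}$ is applied to $w\in V^{\otimes d}$. *)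

theory Defs
  imports
    "HOL-Analysis.Product_Vector"
    "HOL-Library.Poly_Mapping"
    "HOL-Library.Set_Algebras"
begin

section \<open>Free vector spaces\<close>

definition free_scale :: "'k::field \<Rightarrow> ('b \<Rightarrow>\<^sub>0 'k) \<Rightarrow> ('b \<Rightarrow>\<^sub>0 'k)"
  where "free_scale c = Poly_Mapping.map ((*) c)"

lemma lookup_free_scale [simp]:
  "Poly_Mapping.lookup (free_scale c p) b = c * Poly_Mapping.lookup p b"
  by (simp add: free_scale_def Poly_Mapping.map.rep_eq when_def)

lemma vector_space_free_scale: "vector_space (free_scale :: 'k::field \<Rightarrow> ('b \<Rightarrow>\<^sub>0 'k) \<Rightarrow> _)"
  by unfold_locales
    (auto intro!: poly_mapping_eqI simp: Poly_Mapping.lookup_add algebra_simps)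

text \<open>The linear extension of a map of basis elements.\<close>

definition free_map :: "('a \<Rightarrow> 'b) \<Rightarrow> ('a \<Rightarrow>\<^sub>0 'k::field) \<Rightarrow> ('b \<Rightarrow>\<^sub>0 'k)"
  where "free_map g p =
    (\<Sum>a\<in>Poly_Mapping.keys p. Poly_Mapping.single (g a) (Poly_Mapping.lookup p a))"

lemma free_map_eq_sum:
  assumes "finite A" "Poly_Mapping.keys p \<subseteq> A"
  shows "free_map g p = (\<Sum>a\<in>A. Poly_Mapping.single (g a) (Poly_Mapping.lookup p a))"
  unfolding free_map_def
  by (rule sum.mono_neutral_left) (use assms in \<open>auto simp: Poly_Mapping.in_keys_iff\<close>)

lemma free_map_single [simp]:
  "free_map g (Poly_Mapping.single a c) = Poly_Mapping.single (g a) c"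
  by (subst free_map_eq_sum [where A = "{a}"]) auto

lemma free_map_add: "free_map g (p + q) = free_map g p + free_map g q"
proof -
  let ?A = "Poly_Mapping.keys p \<union> Poly_Mapping.keys q"
  have "Poly_Mapping.keys (p + q) \<subseteq> ?A"
    by (rule Poly_Mapping.keys_add)
  then show ?thesis
    by (simp add: free_map_eq_sum [where A = ?A] Poly_Mapping.lookup_add
        Poly_Mapping.single_add sum.distrib)
qed

section \<open>Tensor powers\<close>

text \<open>
  The \<open>m\<close>-th tensor power of the vector space with scalar multiplication \<open>s\<close> is the free vector
  space on the \<open>m\<close>-tuples of vectors (lists of length \<open>m\<close>), modulo the subspace
  \<open>tensor_null s m\<close> spanned by the relations of multilinearity.  Its elements are cosets of
  that subspace.
\<close>

definition tensor_relations ::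
    "('k::field \<Rightarrow> 'v::ab_group_add \<Rightarrow> 'v) \<Rightarrow> nat \<Rightarrow> ('v list \<Rightarrow>\<^sub>0 'k) set"
  where "tensor_relations s m =
    {Poly_Mapping.single (xs @ [x + y] @ ys) 1
       - Poly_Mapping.single (xs @ [x] @ ys) 1 - Poly_Mapping.single (xs @ [y] @ ys) 1
     | xs ys x y. length xs + 1 + length ys = m}
    \<union> {Poly_Mapping.single (xs @ [s c x] @ ys) 1 - Poly_Mapping.single (xs @ [x] @ ys) c
     | xs ys x c. length xs + 1 + length ys = m}"

definition tensor_null ::
    "('k::field \<Rightarrow> 'v::ab_group_add \<Rightarrow> 'v) \<Rightarrow> nat \<Rightarrow> ('v list \<Rightarrow>\<^sub>0 'k) set"
  where "tensor_null s m = module.span free_scale (tensor_relations s m)"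

definition tensor_power ::
    "('k::field \<Rightarrow> 'v::ab_group_add \<Rightarrow> 'v) \<Rightarrow> nat \<Rightarrow> ('v list \<Rightarrow>\<^sub>0 'k) set set"
  where "tensor_power s m =
    (\<lambda>p. p +o tensor_null s m) ` {p. \<forall>xs\<in>Poly_Mapping.keys p. length xs = m}"

definition pure_tensor ::
    "('k::field \<Rightarrow> 'v::ab_group_add \<Rightarrow> 'v) \<Rightarrow> 'v list \<Rightarrow> ('v list \<Rightarrow>\<^sub>0 'k) set"
  where "pure_tensor s xs = Poly_Mapping.single xs 1 +o tensor_null s (length xs)"

text \<open>
  Addition in the quotient is addition of cosets, i.e. the addition of sets from
  \<^theory>\<open>HOL-Library.Set_Algebras\<close>.  Nonempty finite sums in a tensor power are therefore
  ordinary sums of sets (the empty sum of sets is \<open>{0}\<close>, not the zero coset).  In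
  \<open>tensor_scale\<close> the summand \<open>tensor_null s m\<close> only matters for the scalar \<open>0\<close>.
\<close>

definition tensor_scale ::
    "('k::field \<Rightarrow> 'v::ab_group_add \<Rightarrow> 'v) \<Rightarrow> nat \<Rightarrow> 'k
      \<Rightarrow> ('v list \<Rightarrow>\<^sub>0 'k) set \<Rightarrow> ('v list \<Rightarrow>\<^sub>0 'k) set"
  where "tensor_scale s m c u = free_scale c ` u + tensor_null s m"

text \<open>
  \<open>tensor_map s m g\<close> is the linear map into the \<open>m\<close>-th tensor power (with respect to \<open>s\<close>)
  induced on a tensor power by sending the pure tensor of \<open>xs\<close> to the pure tensor of \<open>g xs\<close>.
  It is meant for \<open>g\<close> such that the latter depends multilinearly on \<open>xs\<close>.
\<close>

definition tensor_map ::
    "('k::field \<Rightarrow> 'w::ab_group_add \<Rightarrow> 'w) \<Rightarrow> nat \<Rightarrow> ('v list \<Rightarrow> 'w list)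
      \<Rightarrow> ('v list \<Rightarrow>\<^sub>0 'k) set \<Rightarrow> ('w list \<Rightarrow>\<^sub>0 'k) set"
  where "tensor_map s m g u = free_map g ` u + tensor_null s m"

lemma tensor_map_coset:
  fixes s :: "'k::field \<Rightarrow> 'v::ab_group_add \<Rightarrow> 'v"
    and s' :: "'k \<Rightarrow> 'w::ab_group_add \<Rightarrow> 'w"
  assumes "free_map g ` tensor_null s m \<subseteq> tensor_null s' m'"
  shows "tensor_map s' m' g (p +o tensor_null s m) = free_map g p +o tensor_null s' m'"
proof -
  interpret F: vector_space "free_scale :: 'k \<Rightarrow> ('w list \<Rightarrow>\<^sub>0 'k) \<Rightarrow> _"
    by (rule vector_space_free_scale)
  interpret E: vector_space "free_scale :: 'k \<Rightarrow> ('v list \<Rightarrow>\<^sub>0 'k) \<Rightarrow> _"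
    by (rule vector_space_free_scale)
  have 0: "0 \<in> tensor_null s m"
    unfolding tensor_null_def by (rule E.span_zero)
  have add: "x + y \<in> tensor_null s' m'" if "x \<in> tensor_null s' m'" "y \<in> tensor_null s' m'" for x y
    using that unfolding tensor_null_def by (rule F.span_add)
  have "tensor_map s' m' g (p +o tensor_null s m)
      = {free_map g p + (free_map g n + n') | n n'. n \<in> tensor_null s m \<and> n' \<in> tensor_null s' m'}"
    by (force simp: tensor_map_def set_plus_def elt_set_plus_def free_map_add add.assoc)
  also have "\<dots> = free_map g p +o tensor_null s' m'"
  proof
    show "{free_map g p + (free_map g n + n') | n n'. n \<in> tensor_null s m \<and> n' \<in> tensor_null s' m'}
        \<subseteq> free_map g p +o tensor_null s' m'"
      using assms add by (auto simp: elt_set_plus_def)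
    have "free_map g 0 = 0"
      by (simp add: free_map_def)
    then show "free_map g p +o tensor_null s' m'
        \<subseteq> {free_map g p + (free_map g n + n') | n n'. n \<in> tensor_null s m \<and> n' \<in> tensor_null s' m'}"
      using 0 by (force simp: elt_set_plus_def)
  qed
  finally show ?thesis .
qed

lemma tensor_map_pure_tensor:
  assumes "free_map g ` tensor_null s (length xs) \<subseteq> tensor_null s' m'" "length (g xs) = m'"
  shows "tensor_map s' m' g (pure_tensor s xs) = pure_tensor s' (g xs)"
  using assms by (simp add: pure_tensor_def tensor_map_coset)

section \<open>Flips and superpotentials\<close>

text \<open>
  The flip of the tensor factors with (zero-based) positions \<open>k\<close> and \<open>k + 1\<close>, that is
  \<open>1\<close> (\<open>k\<close> times) tensor the flip tensor \<open>1\<close> (\<open>m - k - 2\<close> times).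
\<close>

definition flip_at ::
    "('k::field \<Rightarrow> 'v::ab_group_add \<Rightarrow> 'v) \<Rightarrow> nat \<Rightarrow> nat
      \<Rightarrow> ('v list \<Rightarrow>\<^sub>0 'k) set \<Rightarrow> ('v list \<Rightarrow>\<^sub>0 'k) set"
  where "flip_at s m k =
    tensor_map s m (\<lambda>xs. take k xs @ [xs ! Suc k, xs ! k] @ drop (k + 2) xs)"

primrec tau ::
    "('k::field \<Rightarrow> 'v::ab_group_add \<Rightarrow> 'v) \<Rightarrow> nat \<Rightarrow> nat
      \<Rightarrow> ('v list \<Rightarrow>\<^sub>0 'k) set \<Rightarrow> ('v list \<Rightarrow>\<^sub>0 'k) set"
  where
    "tau s m 0 = (\<lambda>u. u)"
  | "tau s m (Suc k) = flip_at s m k \<circ> tau s m k"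

text \<open>\<open>f\<close> applied to the first \<open>i\<close> of \<open>m\<close> tensor factors.\<close>

definition map_first ::
    "('k::field \<Rightarrow> 'v::ab_group_add \<Rightarrow> 'v) \<Rightarrow> nat \<Rightarrow> nat \<Rightarrow> ('v \<Rightarrow> 'v)
      \<Rightarrow> ('v list \<Rightarrow>\<^sub>0 'k) set \<Rightarrow> ('v list \<Rightarrow>\<^sub>0 'k) set"
  where "map_first s m i f = tensor_map s m (\<lambda>xs. map f (take i xs) @ drop i xs)"

definition twisted_superpotential ::
    "('k::field \<Rightarrow> 'v::ab_group_add \<Rightarrow> 'v) \<Rightarrow> nat \<Rightarrow> ('v \<Rightarrow> 'v) \<Rightarrow> ('v list \<Rightarrow>\<^sub>0 'k) set \<Rightarrow> bool"
  where "twisted_superpotential s m \<sigma> u \<longleftrightarrow>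
    u \<in> tensor_power s m \<and>
    u = tensor_scale s m ((-1) ^ (m - 1)) (tau s m (m - 1) (map_first s m 1 \<sigma> u))"

definition superpotential ::
    "('k::field \<Rightarrow> 'v::ab_group_add \<Rightarrow> 'v) \<Rightarrow> nat \<Rightarrow> ('v list \<Rightarrow>\<^sub>0 'k) set \<Rightarrow> bool"
  where "superpotential s m u \<longleftrightarrow> twisted_superpotential s m (\<lambda>x. x) u"

text \<open>
  Adjoining an indeterminate \<open>z = (0, 1)\<close>: the direct sum of \<open>V\<close> and the line spanned by \<open>z\<close>
  is \<open>V \<times> k\<close>, in which \<open>V\<close> is embedded by \<open>v \<mapsto> (v, 0)\<close>.
\<close>

abbreviation adjoin_scale ::
    "('k::field \<Rightarrow> 'v::ab_group_add \<Rightarrow> 'v) \<Rightarrow> 'k \<Rightarrow> 'v \<times> 'k \<Rightarrow> 'v \<times> 'k"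
  where "adjoin_scale s \<equiv> module_prod.scale s (*)"

text \<open>The map sending \<open>u\<close> in the \<open>m\<close>-th tensor power of \<open>V\<close> to \<open>z\<close> tensor \<open>u\<close>.\<close>

definition z_tensor ::
    "('k::field \<Rightarrow> 'v::ab_group_add \<Rightarrow> 'v) \<Rightarrow> nat
      \<Rightarrow> ('v list \<Rightarrow>\<^sub>0 'k) set \<Rightarrow> (('v \<times> 'k) list \<Rightarrow>\<^sub>0 'k) set"
  where "z_tensor s m = tensor_map (adjoin_scale s) (m + 1) (\<lambda>xs. (0, 1) # map (\<lambda>v. (v, 0)) xs)"

definition w_hat ::
    "('k::field \<Rightarrow> 'v::ab_group_add \<Rightarrow> 'v) \<Rightarrow> nat \<Rightarrow> ('v \<Rightarrow> 'v)
      \<Rightarrow> ('v list \<Rightarrow>\<^sub>0 'k) set \<Rightarrow> (('v \<times> 'k) list \<Rightarrow>\<^sub>0 'k) set"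
  where "w_hat s d \<sigma> w =
    (\<Sum>i = 0..d. tensor_scale (adjoin_scale s) (d + 1) ((-1) ^ i)
      (tau (adjoin_scale s) (d + 1) i (z_tensor s d (map_first s d i \<sigma> w))))"

end

theory Submission
  imports Defs
begin

text \<open>
  On pure tensors, moving \<open>z\<close> from the front to position \<open>i\<close> after applying \<open>\<sigma>\<close> to the first
  \<open>i\<close> factors is \<open>insert_z \<sigma> i\<close>.  The cyclic rotation turns the term of index \<open>i + 1\<close> of
  \<open>w_hat\<close> into the term of index \<open>i\<close> evaluated at the twisted rotation of \<open>w\<close>, which is
  \<open>\<plusminus>w\<close>.  The term of index \<open>0\<close> is rotated to the term of index \<open>d\<close> with \<open>w\<close> in place of
  \<open>\<sigma>\<^sup>\<otimes>\<^sup>d w\<close>; these agree because \<open>\<sigma>\<^sup>\<otimes>\<^sup>d\<close> is the \<open>d\<close>-th power of the twisted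
  rotation, whose sign is \<open>(-1)\<^bsup>(d - 1) d\<^esup> = 1\<close>.
\<close>

section \<open>Linear extensions and cosets\<close>

interpretation free: vector_space "free_scale :: 'k::field \<Rightarrow> ('b \<Rightarrow>\<^sub>0 'k) \<Rightarrow> _"
  by (rule vector_space_free_scale)

lemma free_scale_single [simp]:
  "free_scale c (Poly_Mapping.single a b) = Poly_Mapping.single a (c * b)"
  by (rule poly_mapping_eqI) (simp add: lookup_single when_def)

lemma free_map_scale: "free_map g (free_scale c p) = free_scale c (free_map g p)"
proof -
  have "Poly_Mapping.keys (free_scale c p) \<subseteq> Poly_Mapping.keys p"
    by (auto simp: Poly_Mapping.in_keys_iff)
  then show ?thesis
    by (simp add: free_map_eq_sum [where A = "Poly_Mapping.keys p"] free.scale_sum_right)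
qed

lemma module_hom_free_map: "module_hom free_scale free_scale (free_map g)"
  by unfold_locales (auto simp: free_map_add free_map_scale)

lemmas free_map_diff = module_hom.diff [OF module_hom_free_map]
  and free_map_sum = module_hom.sum [OF module_hom_free_map]

lemma free_map_free_map: "free_map g (free_map h p) = free_map (\<lambda>x. g (h x)) p"
  by (simp add: free_map_def [of h] free_map_def [of "\<lambda>x. g (h x)"] free_map_sum)

lemma free_map_cong:
  "(\<And>x. x \<in> Poly_Mapping.keys p \<Longrightarrow> g x = h x) \<Longrightarrow> free_map g p = free_map h p"
  by (simp add: free_map_def)

lemma free_map_ident: "free_map (\<lambda>x. x) p = p"
  unfolding free_map_def
  by (rule poly_mapping_eqI)
    (auto simp: lookup_sum lookup_single when_def Poly_Mapping.in_keys_iff)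

lemma keys_free_map: "Poly_Mapping.keys (free_map g p) \<subseteq> g ` Poly_Mapping.keys p"
  unfolding free_map_def using keys_sum by (fastforce split: if_splits)

lemma keys_free_scale: "Poly_Mapping.keys (free_scale c p) \<subseteq> Poly_Mapping.keys p"
  by (auto simp: Poly_Mapping.in_keys_iff)

section \<open>Arithmetic of cosets of the null space\<close>

lemma subspace_tensor_null: "free.subspace (tensor_null s m)"
  by (simp add: tensor_null_def)

lemma tensor_null_add_null: "tensor_null s m + tensor_null s m = tensor_null s m"
proof
  show "tensor_null s m + tensor_null s m \<subseteq> tensor_null s m"
    using free.subspace_add [OF subspace_tensor_null, of _ s m] by (auto simp: set_plus_def)
  show "tensor_null s m \<subseteq> tensor_null s m + tensor_null s m"
    by (rule set_zero_plus2) (rule free.subspace_0 [OF subspace_tensor_null])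
qed

text \<open>Turns equations between tensors into membership statements about representatives, so
  that later arguments take place in the free vector space.\<close>

lemma coset_eq_iff:
  "p +o tensor_null s m = q +o tensor_null s m \<longleftrightarrow> p - q \<in> tensor_null s m"
proof
  assume eq: "p +o tensor_null s m = q +o tensor_null s m"
  have "p + 0 \<in> p +o tensor_null s m"
    using free.subspace_0 [OF subspace_tensor_null] by (rule set_plus_intro2)
  then show "p - q \<in> tensor_null s m"
    using eq set_plus_imp_minus by force
next
  have *: "p +o tensor_null s m \<subseteq> q +o tensor_null s m" if "p - q \<in> tensor_null s m" for p q
  proof -
    have "p +o tensor_null s m = q +o ((p - q) +o tensor_null s m)"
      by (simp add: set_plus_rearrange2)
    also have "\<dots> \<subseteq> q +o tensor_null s m"
      using that free.subspace_add [OF subspace_tensor_null, of "p - q" s m]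
      by (auto simp: elt_set_plus_def)
    finally show ?thesis .
  qed
  assume "p - q \<in> tensor_null s m"
  then show "p +o tensor_null s m = q +o tensor_null s m"
    using * free.subspace_neg [OF subspace_tensor_null, of "p - q" s m] by force
qed

lemma tensor_scale_coset:
  "tensor_scale s m c (p +o tensor_null s m) = free_scale c p +o tensor_null s m"
proof -
  have "tensor_scale s m c (p +o tensor_null s m)
      = free_scale c p +o (free_scale c ` tensor_null s m + tensor_null s m)"
    by (force simp: tensor_scale_def elt_set_plus_def set_plus_def free.scale_right_distrib add.assoc)
  \<comment> \<open>For \<open>c = 0\<close> the image collapses to \<open>{0}\<close>, so it need
    not be the whole null space. Both inclusions avoid a case split: the image lies in the null
    space and contains 0.\<close>
  also have "free_scale c ` tensor_null s m + tensor_null s m = tensor_null s m"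
  proof
    have "free_scale c ` tensor_null s m \<subseteq> tensor_null s m"
      by (intro image_subsetI free.subspace_scale [OF subspace_tensor_null])
    then show "free_scale c ` tensor_null s m + tensor_null s m \<subseteq> tensor_null s m"
      using set_plus_mono2 [OF _ order_refl, of _ _ "tensor_null s m"]
      by (metis tensor_null_add_null)
    have "0 \<in> free_scale c ` tensor_null s m"
      by (rule image_eqI [OF _ free.subspace_0 [OF subspace_tensor_null]]) simp
    then show "tensor_null s m \<subseteq> free_scale c ` tensor_null s m + tensor_null s m"
      by (rule set_zero_plus2)
  qed
  finally show ?thesis .
qed

text \<open>The range \<open>0..n\<close> is never empty, so the induction starts from one coset and
  not from the empty sum of sets \<open>{0}\<close>, for which the equation could fail.\<close>

lemma sum_coset:
  fixes n :: nat
  shows "(\<Sum>i = 0..n. f i +o tensor_null s m) = (\<Sum>i = 0..n. f i) +o tensor_null s m"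
  by (induction n) (simp_all add: set_plus_rearrange tensor_null_add_null)

section \<open>Slotwise linear maps of lists\<close>

text \<open>A sufficient condition for the pure tensor of \<open>g xs\<close> to depend
  multilinearly on \<open>xs\<close>, chosen because it is closed under composition. Each input slot
  feeds a single output slot through a linear map that does not depend on the other entries. Output
  slots fed by no input may hold constants, which leaves room for z.\<close>

definition slotwise ::
    "('k::field \<Rightarrow> 'v::ab_group_add \<Rightarrow> 'v) \<Rightarrow> nat \<Rightarrow> ('k \<Rightarrow> 'w::ab_group_add \<Rightarrow> 'w) \<Rightarrow> nat
      \<Rightarrow> ('v list \<Rightarrow> 'w list) \<Rightarrow> bool"
  where "slotwise s m s' m' g \<longleftrightarrow>
    (\<forall>xs. length xs = m \<longrightarrow> length (g xs) = m') \<and>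
    (\<forall>i<m. \<exists>j<m'. \<exists>f. module_hom s s' f \<and>
      (\<forall>xs x. length xs = m \<longrightarrow> g (xs[i := x]) = (g xs)[j := f x]))"

lemma slotwise_cong:
  assumes "\<And>xs. length xs = m \<Longrightarrow> g xs = h xs"
  shows "slotwise s m s' m' g \<longleftrightarrow> slotwise s m s' m' h"
  using assms by (simp add: slotwise_def)

lemma slotwise_compose:
  assumes "slotwise s m s' m' g" "slotwise s' m' s'' m'' h"
  shows "slotwise s m s'' m'' (\<lambda>xs. h (g xs))"
  unfolding slotwise_def
proof (intro conjI allI impI)
  fix i assume "i < m"
  then obtain j f where j: "j < m'" and f: "module_hom s s' f"
    "\<And>xs x. length xs = m \<Longrightarrow> g (xs[i := x]) = (g xs)[j := f x]"
    using assms(1) unfolding slotwise_def by blast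
  obtain l f' where l: "l < m''" and f': "module_hom s' s'' f'"
    "\<And>xs x. length xs = m' \<Longrightarrow> h (xs[j := x]) = (h xs)[l := f' x]"
    using j assms(2) unfolding slotwise_def by blast
  show "\<exists>l<m''. \<exists>f. module_hom s s'' f \<and>
      (\<forall>xs x. length xs = m \<longrightarrow> h (g (xs[i := x])) = (h (g xs))[l := f x])"
    using l f f' assms(1) module_hom_compose [OF f(1) f'(1)]
    by (intro exI [of _ l] conjI exI [of _ "f' \<circ> f"]) (auto simp: slotwise_def)
qed (use assms in \<open>auto simp: slotwise_def\<close>)

text \<open>Linear images commute with spans, so only generators matter. A relation of additivity or
  homogeneity in one input slot is carried to a relation of the same kind in the output slot that it
  feeds.\<close>

lemma slotwise_tensor_null:
  assumes "slotwise s m s' m' g"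
  shows "free_map g ` tensor_null s m \<subseteq> tensor_null s' m'"
proof -
  have slot: "\<exists>us vs f. length us + 1 + length vs = m' \<and> module_hom s s' f \<and>
      (\<forall>x. g (xs @ [x] @ ys) = us @ [f x] @ vs)"
    if len: "length xs + 1 + length ys = m" for xs ys
  proof -
    obtain j f where j: "j < m'" and f: "module_hom s s' f"
      "\<And>zs x. length zs = m \<Longrightarrow> g (zs[length xs := x]) = (g zs)[j := f x]"
      using assms len unfolding slotwise_def by (metis less_add_one trans_less_add1)
    \<comment> \<open>The entry 0 is a placeholder: only \<open>us\<close> outside position
      \<open>j\<close> is used below, and that part is the same for every entry in the slot.\<close>
    define us where "us = g (xs @ 0 # ys)"
    have us: "length us = m'"
      using assms len by (auto simp: slotwise_def us_def)
    have "g (xs @ [x] @ ys) = take j us @ [f x] @ drop (Suc j) us" for x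
      using f(2) [of "xs @ [0] @ ys" x] len us j
      by (simp add: us_def [symmetric] upd_conv_take_nth_drop)
    then show ?thesis
      using j f(1) us
      by (intro exI [of _ "take j us"] exI [of _ "drop (Suc j) us"] exI [of _ f]) auto
  qed
  have "free_map g ` tensor_relations s m \<subseteq> tensor_relations s' m'"
  proof
    fix r assume "r \<in> free_map g ` tensor_relations s m"
    then consider
        (add) xs ys x y where "length xs + 1 + length ys = m"
          "r = free_map g (Poly_Mapping.single (xs @ [x + y] @ ys) 1
            - Poly_Mapping.single (xs @ [x] @ ys) 1 - Poly_Mapping.single (xs @ [y] @ ys) 1)"
      | (scale) xs ys x c where "length xs + 1 + length ys = m"
          "r = free_map g (Poly_Mapping.single (xs @ [s c x] @ ys) 1
            - Poly_Mapping.single (xs @ [x] @ ys) c)"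
      unfolding tensor_relations_def by blast
    then show "r \<in> tensor_relations s' m'"
    proof cases
      case add
      obtain us vs f where f: "length us + 1 + length vs = m'" "module_hom s s' f"
        "\<And>x. g (xs @ [x] @ ys) = us @ [f x] @ vs"
        using slot [OF add(1)] by blast
      have "r = Poly_Mapping.single (us @ [f x + f y] @ vs) 1
          - Poly_Mapping.single (us @ [f x] @ vs) 1 - Poly_Mapping.single (us @ [f y] @ vs) 1"
        unfolding add(2) free_map_diff free_map_single f(3) module_hom.add [OF f(2)] ..
      then show ?thesis using f(1) unfolding tensor_relations_def by blast
    next
      case scale
      obtain us vs f where f: "length us + 1 + length vs = m'" "module_hom s s' f"
        "\<And>x. g (xs @ [x] @ ys) = us @ [f x] @ vs"
        using slot [OF scale(1)] by blast
      have "r = Poly_Mapping.single (us @ [s' c (f x)] @ vs) 1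
          - Poly_Mapping.single (us @ [f x] @ vs) c"
        unfolding scale(2) free_map_diff free_map_single f(3) module_hom.scale [OF f(2)] ..
      then show ?thesis using f(1) unfolding tensor_relations_def by blast
    qed
  qed
  then show ?thesis
    unfolding tensor_null_def module_hom.span_image [OF module_hom_free_map, symmetric]
    by (rule free.span_mono)
qed

lemma tensor_map_slotwise:
  "slotwise s m s' m' g \<Longrightarrow>
    tensor_map s' m' g (p +o tensor_null s m) = free_map g p +o tensor_null s' m'"
  by (intro tensor_map_coset slotwise_tensor_null)

lemma slotwise_map_first:
  assumes "module_hom s s f"
  shows "slotwise s m s m (\<lambda>xs. map f (take i xs) @ drop i xs)"
  unfolding slotwise_def
proof (intro conjI allI impI)
  fix j assume j: "j < m"
  have "module_hom s s (if j < i then f else (\<lambda>x. x))"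
    using assms module.module_hom_ident [of s] by (auto simp: module_hom_def)
  then show "\<exists>l<m. \<exists>h. module_hom s s h \<and> (\<forall>xs x. length xs = m \<longrightarrow>
      map f (take i (xs[j := x])) @ drop i (xs[j := x]) = (map f (take i xs) @ drop i xs)[l := h x])"
    using j by (intro exI [of _ j] conjI exI [of _ "if j < i then f else (\<lambda>x. x)"] allI impI)
      (auto intro!: nth_equalityI simp: nth_append nth_list_update)
qed auto

lemma slotwise_flip:
  assumes "module s" "Suc k < m"
  shows "slotwise s m s m (\<lambda>xs. take k xs @ [xs ! Suc k, xs ! k] @ drop (k + 2) xs)"
  unfolding slotwise_def
proof (intro conjI allI impI)
  fix j assume j: "j < m"
  let ?l = "if j = k then Suc k else if j = Suc k then k else j"
  show "\<exists>l<m. \<exists>h. module_hom s s h \<and> (\<forall>xs x. length xs = m \<longrightarrow>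
      take k (xs[j := x]) @ [xs[j := x] ! Suc k, xs[j := x] ! k] @ drop (k + 2) (xs[j := x])
        = (take k xs @ [xs ! Suc k, xs ! k] @ drop (k + 2) xs)[l := h x])"
    using j assms module.module_hom_ident [OF assms(1)]
    by (intro exI [of _ ?l] conjI exI [of _ "\<lambda>x. x"] allI impI)
      (auto intro!: nth_equalityI simp: nth_append nth_list_update nth_Cons' split: if_splits)
qed (use assms in auto)

text \<open>Input slot j feeds output slot j + 1. No input reaches the head, so the fixed entry
  \<open>z\<close> does no harm to multilinearity.\<close>

lemma slotwise_Cons_map:
  assumes "module_hom s s' f"
  shows "slotwise s m s' (Suc m) (\<lambda>xs. z # map f xs)"
  unfolding slotwise_def
proof (intro conjI allI impI)
  fix j assume "j < m"
  then show "\<exists>l<Suc m. \<exists>h. module_hom s s' h \<and> (\<forall>xs x. length xs = m \<longrightarrow>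
      z # map f (xs[j := x]) = (z # map f xs)[l := h x])"
    using assms by (intro exI [of _ "Suc j"] exI [of _ f]) (auto simp: map_update)
qed auto

section \<open>Cyclic moves\<close>

text \<open>The closed form on lists of \<open>tau s m k\<close>, the composite of the first k
  adjacent flips.\<close>

definition move_head :: "nat \<Rightarrow> 'v list \<Rightarrow> 'v list"
  where "move_head k xs = take k (tl xs) @ [hd xs] @ drop k (tl xs)"

text \<open>After \<open>move_head k\<close> the former head sits at zero-based position k, and the
  flip of positions k and k + 1 pushes it one place further.\<close>

lemma move_head_Suc:
  assumes "Suc k < length xs"
  shows "take k (move_head k xs) @ [move_head k xs ! Suc k, move_head k xs ! k]
    @ drop (k + 2) (move_head k xs) = move_head (Suc k) xs"
proof -
  obtain x ys where xs: "xs = x # ys" "k < length ys"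
    using assms by (cases xs) auto
  then show ?thesis
    by (auto simp: move_head_def nth_append take_Suc_conv_app_nth)
qed

lemma slotwise_move_head:
  assumes "module s" "k < m"
  shows "slotwise s m s m (move_head k)"
  using assms(2)
proof (induction k)
  case 0
  have "xs = move_head 0 xs" if "length xs = m" for xs :: "'b list"
    using that 0 by (cases xs) (auto simp: move_head_def)
  then have "slotwise s m s m (\<lambda>xs. xs) \<longleftrightarrow> ?case"
    by (rule slotwise_cong)
  then show ?case
    \<comment> \<open>The identity on lists is the instance in which the linear map is applied to
      the first 0 factors.\<close>
    using slotwise_map_first [OF module.module_hom_ident [OF assms(1)], of m 0] by simp
next
  case (Suc k)
  then have "slotwise s m s m (\<lambda>xs. take k (move_head k xs)
      @ [move_head k xs ! Suc k, move_head k xs ! k] @ drop (k + 2) (move_head k xs))"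
    using slotwise_compose [OF _ slotwise_flip [OF assms(1) Suc.prems], of s m "move_head k"]
    by simp
  also have "?this \<longleftrightarrow> ?case"
    using Suc.prems by (intro slotwise_cong move_head_Suc) simp
  finally show ?case .
qed

text \<open>Induction on the number of flips. The list identities behind it hold only for long
  enough lists (already \<open>move_head 0\<close> is the identity only on nonempty ones), hence the
  condition on the keys of \<open>p\<close>.\<close>

lemma tau_coset:
  assumes "module s" "\<And>xs. xs \<in> Poly_Mapping.keys p \<Longrightarrow> length xs = m" "k < m"
  shows "tau s m k (p +o tensor_null s m) = free_map (move_head k) p +o tensor_null s m"
  using assms(3)
proof (induction k)
  case 0
  have "free_map (move_head 0) p = free_map (\<lambda>xs. xs) p"
  proof (rule free_map_cong)
    fix xs assume "xs \<in> Poly_Mapping.keys p"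
    then show "move_head 0 xs = xs"
      using assms(2) [of xs] 0 by (cases xs) (auto simp: move_head_def)
  qed
  then show ?case by (simp add: free_map_ident)
next
  case (Suc k)
  have "tau s m (Suc k) (p +o tensor_null s m)
      = flip_at s m k (free_map (move_head k) p +o tensor_null s m)"
    using Suc by simp
  also have "\<dots> = free_map (\<lambda>xs. take k (move_head k xs)
      @ [move_head k xs ! Suc k, move_head k xs ! k] @ drop (k + 2) (move_head k xs)) p
      +o tensor_null s m"
    unfolding flip_at_def tensor_map_slotwise [OF slotwise_flip [OF assms(1) Suc.prems]]
      free_map_free_map ..
  also have "\<dots> = free_map (move_head (Suc k)) p +o tensor_null s m"
    using assms(2) Suc.prems
    by (intro arg_cong2 [where f = "(+o)"] free_map_cong refl move_head_Suc) auto
  finally show ?case .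
qed

text \<open>The list form of the operator in the definition of a twisted superpotential: \<sigma> on
  the first factor, followed by the full cyclic move \<open>tau s m (m - 1)\<close>.\<close>

definition twisted_rotate :: "('v \<Rightarrow> 'v) \<Rightarrow> 'v list \<Rightarrow> 'v list"
  where "twisted_rotate \<sigma> xs = tl xs @ [\<sigma> (hd xs)]"

text \<open>Each step takes a fresh head as long as \<open>i\<close> does not exceed the length. At
  \<open>i = length xs\<close> every entry has met \<sigma> exactly once and the original order is
  restored, so this power is \<open>map \<sigma>\<close>.\<close>

lemma twisted_rotate_funpow:
  "i \<le> length xs \<Longrightarrow> (twisted_rotate \<sigma> ^^ i) xs = drop i xs @ map \<sigma> (take i xs)"
proof (induction i)
  case (Suc i)
  then have "drop i xs = xs ! i # drop (Suc i) xs"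
    by (simp add: Cons_nth_drop_Suc)
  then show ?case
    using Suc by (simp add: twisted_rotate_def take_Suc_conv_app_nth)
qed simp

lemma move_head_map_first:
  assumes "length xs = m" "0 < m"
  shows "move_head (m - 1) (map \<sigma> (take 1 xs) @ drop 1 xs) = twisted_rotate \<sigma> xs"
  using assms by (cases xs) (auto simp: move_head_def twisted_rotate_def)

lemma slotwise_twisted_rotate:
  assumes "module_hom s s \<sigma>" "0 < m"
  shows "slotwise s m s m (twisted_rotate \<sigma>)"
proof -
  have "module s" using assms(1) by (simp add: module_hom_def)
  then have "slotwise s m s m (\<lambda>xs. move_head (m - 1) (map \<sigma> (take 1 xs) @ drop 1 xs))"
    using slotwise_compose [OF slotwise_map_first [OF assms(1)] slotwise_move_head] assms(2)
    by fastforce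
  also have "?this \<longleftrightarrow> ?thesis"
    using assms(2) by (intro slotwise_cong move_head_map_first)
  finally show ?thesis .
qed

text \<open>Used in both directions: with \<sigma> to exploit the hypothesis on w, and with the
  identity to establish the conclusion for \<open>w_hat\<close>.\<close>

lemma twisted_superpotential_coset_iff:
  assumes "module_hom s s \<sigma>" "\<And>xs. xs \<in> Poly_Mapping.keys p \<Longrightarrow> length xs = m" "0 < m"
  shows "twisted_superpotential s m \<sigma> (p +o tensor_null s m) \<longleftrightarrow>
    p - free_scale ((-1) ^ (m - 1)) (free_map (twisted_rotate \<sigma>) p) \<in> tensor_null s m"
proof -
  let ?g = "\<lambda>xs. map \<sigma> (take 1 xs) @ drop 1 xs"
  have mod: "module s" using assms(1) by (simp add: module_hom_def)
  have len: "length xs = m" if xs: "xs \<in> Poly_Mapping.keys (free_map ?g p)" for xs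
  proof -
    obtain ys where "ys \<in> Poly_Mapping.keys p" "xs = ?g ys"
      using subsetD [OF keys_free_map xs] by blast
    then show ?thesis using assms(2) by auto
  qed
  have "tau s m (m - 1) (map_first s m 1 \<sigma> (p +o tensor_null s m))
      = free_map (move_head (m - 1)) (free_map ?g p) +o tensor_null s m"
    unfolding map_first_def tensor_map_slotwise [OF slotwise_map_first [OF assms(1)]]
    using mod len diff_less [OF zero_less_one assms(3)] by (rule tau_coset)
  also have "free_map (move_head (m - 1)) (free_map ?g p) = free_map (twisted_rotate \<sigma>) p"
    unfolding free_map_free_map
    using assms(2,3) by (intro free_map_cong move_head_map_first) auto
  finally show ?thesis
    using assms(2)
    by (auto simp: twisted_superpotential_def tensor_power_def tensor_scale_coset coset_eq_iff)
qed

lemma twisted_superpotential_invariant: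
  assumes "module_hom s s \<sigma>" "\<And>xs. xs \<in> Poly_Mapping.keys p \<Longrightarrow> length xs = m" "0 < m"
    and "twisted_superpotential s m \<sigma> (p +o tensor_null s m)"
  shows "p - free_map (map \<sigma>) p \<in> tensor_null s m"
proof -
  let ?c = "(-1) ^ (m - 1) :: 'a" and ?T = "twisted_rotate \<sigma>"
  note null_add = free.subspace_add [OF subspace_tensor_null]
  have T: "p - free_scale ?c (free_map ?T p) \<in> tensor_null s m"
    using assms twisted_superpotential_coset_iff by blast
  \<comment> \<open>Write c for the sign and T for the rotation. The induction step adds
    \<open>p - c T p\<close> and \<open>c T (p - c^i T^i p)\<close>. The second summand is null
    because T preserves the null space.\<close>
  have pow: "p - free_scale (?c ^ i) (free_map (?T ^^ i) p) \<in> tensor_null s m" for i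
  proof (induction i)
    case 0
    then show ?case
      by (simp add: id_def free_map_ident free.subspace_0 [OF subspace_tensor_null])
  next
    case (Suc i)
    have "free_scale ?c (free_map ?T (p - free_scale (?c ^ i) (free_map (?T ^^ i) p)))
        \<in> tensor_null s m"
      using Suc slotwise_tensor_null [OF slotwise_twisted_rotate [OF assms(1,3)]]
      by (intro free.subspace_scale [OF subspace_tensor_null]) blast
    from null_add [OF T this] show ?case
      by (simp add: free_map_diff free_map_scale free_map_free_map free.scale_right_diff_distrib
          comp_def)
  qed
  have "even ((m - 1) * m)" by (cases m) auto
  then have "?c ^ m = 1"
    unfolding power_mult [symmetric] by (rule neg_one_even_power)
  moreover have "free_map (?T ^^ m) p = free_map (map \<sigma>) p"
    using assms(2) by (intro free_map_cong) (simp add: twisted_rotate_funpow)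
  ultimately show ?thesis
    using pow [of m] by simp
qed

section \<open>Adjoining an indeterminate\<close>

lemma module_hom_adjoin:
  fixes s :: "'k::field \<Rightarrow> 'v::ab_group_add \<Rightarrow> 'v"
  assumes "vector_space s"
  shows "module_hom s (adjoin_scale s) (\<lambda>v. (v, 0))"
proof -
  interpret vector_space_prod s "(*) :: 'k \<Rightarrow> 'k \<Rightarrow> 'k"
    using assms
    by (intro vector_space_prod.intro vector_space_pair.intro)
      (auto intro: vector_space.intro simp: algebra_simps)
  show ?thesis
    unfolding module_hom_iff using p.module_axioms vs1.module_axioms
    by (simp add: scale_prod)
qed

section \<open>The terms of \<open>w_hat\<close> on representatives\<close>

definition insert_z :: "('v::zero \<Rightarrow> 'v) \<Rightarrow> nat \<Rightarrow> 'v list \<Rightarrow> ('v \<times> 'k::{zero, one}) list"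
  where "insert_z \<sigma> i xs =
    map (\<lambda>v. (\<sigma> v, 0)) (take i xs) @ [(0, 1)] @ map (\<lambda>v. (v, 0)) (drop i xs)"

lemma insert_z_eq_move_head:
  assumes "i \<le> length xs"
  shows "insert_z \<sigma> i xs
    = move_head i ((0, 1) # map (\<lambda>v. (v, 0)) (map \<sigma> (take i xs) @ drop i xs))"
  using assms by (simp add: insert_z_def move_head_def comp_def)

lemma length_insert_z: "length (insert_z \<sigma> i xs) = Suc (length xs)"
  by (simp add: insert_z_def)

text \<open>Follows from factoring \<open>insert_z\<close> into \<sigma> on the first factors,
  prepending z, and a cyclic move, each of which is slotwise.\<close>

lemma slotwise_insert_z:
  assumes "vector_space s" "module_hom s s \<sigma>" "i \<le> m"
  shows "slotwise s m (adjoin_scale s) (Suc m) (insert_z \<sigma> i)"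
proof -
  note hom = module_hom_adjoin [OF assms(1)]
  then have "module (adjoin_scale s)" by (simp add: module_hom_def)
  then have "slotwise s m (adjoin_scale s) (Suc m)
      (\<lambda>xs. move_head i ((0, 1) # map (\<lambda>v. (v, 0)) (map \<sigma> (take i xs) @ drop i xs)))"
    using assms(3)
    by (intro slotwise_compose [OF slotwise_compose [OF slotwise_map_first [OF assms(2)]
          slotwise_Cons_map [OF hom]] slotwise_move_head]) auto
  also have "?this \<longleftrightarrow> ?thesis"
    using assms(3) by (intro slotwise_cong insert_z_eq_move_head [symmetric]) simp
  finally show ?thesis .
qed

lemma w_hat_coset:
  fixes s :: "'k::field \<Rightarrow> 'v::ab_group_add \<Rightarrow> 'v"
  assumes "vector_space s" "module_hom s s \<sigma>"
    and len: "\<And>xs. xs \<in> Poly_Mapping.keys p \<Longrightarrow> length xs = d"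
  shows "w_hat s d \<sigma> (p +o tensor_null s d)
    = (\<Sum>i = 0..d. free_scale ((-1) ^ i) (free_map (insert_z \<sigma> i) p))
      +o tensor_null (adjoin_scale s) (d + 1)"
proof -
  let ?s = "adjoin_scale s" and ?z = "(0, 1) :: 'v \<times> 'k"
  note hom = module_hom_adjoin [OF assms(1)]
  then have "module ?s" by (simp add: module_hom_def)
  have "tau ?s (d + 1) i (z_tensor s d (map_first s d i \<sigma> (p +o tensor_null s d)))
      = free_map (insert_z \<sigma> i) p +o tensor_null ?s (d + 1)" if "i \<le> d" for i
  proof -
    let ?g = "\<lambda>xs. ?z # map (\<lambda>v. (v, 0)) (map \<sigma> (take i xs) @ drop i xs)"
    have "z_tensor s d (map_first s d i \<sigma> (p +o tensor_null s d))
        = free_map ?g p +o tensor_null ?s (d + 1)"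
      unfolding map_first_def z_tensor_def tensor_map_slotwise [OF slotwise_map_first [OF assms(2)]]
        tensor_map_slotwise [OF slotwise_Cons_map [OF hom]] Suc_eq_plus1 [symmetric]
        free_map_free_map ..
    moreover have "length xs = d + 1" if "xs \<in> Poly_Mapping.keys (free_map ?g p)" for xs
      using that keys_free_map [of ?g p] len by fastforce
    moreover have "free_map (move_head i) (free_map ?g p) = free_map (insert_z \<sigma> i) p"
      unfolding free_map_free_map
      using len \<open>i \<le> d\<close> by (intro free_map_cong) (simp add: insert_z_eq_move_head)
    ultimately show ?thesis
      using tau_coset [OF \<open>module ?s\<close>, of "free_map ?g p" "d + 1" i] that by simp
  qed
  then show ?thesis
    unfolding w_hat_def
    by (simp add: tensor_scale_coset sum_coset del: sum.atLeast0_atMost_Suc)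
qed

text \<open>With z in front, one rotation sends z to the end. The \<sigma> that
  \<open>insert_z \<sigma> d\<close> applies to all entries has to be supplied by hand, because
  \<open>insert_z \<sigma> 0\<close> applies none.\<close>

lemma twisted_rotate_insert_z_0:
  "length xs = d \<Longrightarrow> insert_z \<sigma> d xs = twisted_rotate (\<lambda>x. x) (insert_z \<sigma> 0 (map \<sigma> xs))"
  by (simp add: insert_z_def twisted_rotate_def comp_def)

text \<open>The head of \<open>insert_z \<sigma> (Suc i) xs\<close> already carries \<sigma>, so an
  untwisted rotation of the longer list acts on the entries from V as a twisted one, while z moves
  one place to the left.\<close>

lemma twisted_rotate_insert_z_Suc:
  assumes "i < length xs"
  shows "twisted_rotate (\<lambda>x. x) (insert_z \<sigma> (Suc i) xs) = insert_z \<sigma> i (twisted_rotate \<sigma> xs)"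
  using assms by (cases xs) (auto simp: insert_z_def twisted_rotate_def)

theorem proposition4p2:
  fixes scale :: "'k::field_char_0 \<Rightarrow> 'v::ab_group_add \<Rightarrow> 'v"
    and B :: "'v set"
    and \<sigma> :: "'v \<Rightarrow> 'v"
    and d :: nat
    and w :: "('v list \<Rightarrow>\<^sub>0 'k) set"
  assumes "finite_dimensional_vector_space scale B"
    and "Vector_Spaces.linear scale scale \<sigma>"
    and "bij \<sigma>"
    and "d \<ge> 2"
    and "twisted_superpotential scale d \<sigma> w"
  shows "superpotential (adjoin_scale scale) (d + 1) (w_hat scale d \<sigma> w)"
proof -
  let ?s = "adjoin_scale scale" and ?T = "twisted_rotate \<sigma>"
  let ?R = "twisted_rotate (\<lambda>x. x) :: ('v \<times> 'k) list \<Rightarrow> _"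
  let ?N = "tensor_null ?s (d + 1)"
  note null = free.subspace_add [OF subspace_tensor_null]
    free.subspace_scale [OF subspace_tensor_null] free.subspace_sum [OF subspace_tensor_null]
  have vs: "vector_space scale"
    using assms(1) by (simp add: finite_dimensional_vector_space_def)
  have hom: "module_hom scale scale \<sigma>"
    using assms(2) by (simp add: module_hom_iff_linear)
  have mod: "module ?s"
    using module_hom_adjoin [OF vs] by (simp add: module_hom_def)
  obtain p where len: "\<And>xs. xs \<in> Poly_Mapping.keys p \<Longrightarrow> length xs = d"
    and w: "w = p +o tensor_null scale d"
    using assms(5) by (auto simp: twisted_superpotential_def tensor_power_def)
  define c :: 'k where "c = (-1) ^ (d - 1)"
  define t :: "nat \<Rightarrow> ('v \<times> 'k) list \<Rightarrow>\<^sub>0 'k"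
    where "t i = free_map (insert_z \<sigma> i) p" for i
  define Q where "Q = (\<Sum>i = 0..d. free_scale ((-1) ^ i) (t i))"
  \<comment> \<open>The sign for degree d + 1 is opposite to the sign for degree d. This is what
    makes the alternating sum match up after rotation.\<close>
  have c: "(-1) ^ d = - c"
    using assms(4) by (cases d) (auto simp: c_def)
  have w_hat: "w_hat scale d \<sigma> w = Q +o ?N"
    unfolding w Q_def t_def using vs hom len by (rule w_hat_coset)
  have T: "p - free_scale c (free_map ?T p) \<in> tensor_null scale d"
    using assms(4,5) len hom unfolding w c_def by (subst (asm) twisted_superpotential_coset_iff) auto
  have inv: "p - free_map (map \<sigma>) p \<in> tensor_null scale d"
    using assms(4,5) len hom unfolding w by (intro twisted_superpotential_invariant) auto
  \<comment> \<open>This is the image under \<open>insert_z \<sigma> i\<close> of the superpotential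
    relation \<open>T\<close> for \<open>p\<close>.\<close>
  have lower: "t i - free_scale c (free_map ?R (t (Suc i))) \<in> ?N" if "i < d" for i
  proof -
    have "free_map ?R (t (Suc i)) = free_map (insert_z \<sigma> i) (free_map ?T p)"
      unfolding t_def free_map_free_map
      using len that by (intro free_map_cong twisted_rotate_insert_z_Suc) simp
    then have "t i - free_scale c (free_map ?R (t (Suc i)))
        = free_map (insert_z \<sigma> i) (p - free_scale c (free_map ?T p))"
      by (simp add: t_def free_map_diff free_map_scale)
    then show ?thesis
      using T slotwise_tensor_null [OF slotwise_insert_z [OF vs hom, of i d]] that by auto
  qed
  \<comment> \<open>The wrap-around term has no neighbour to pair with and needs the invariance
    \<open>inv\<close> of \<open>p\<close> under \<sigma> in all factors. Pushing \<open>inv\<close>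
    forward gives the difference with the opposite sign, hence the negation at the end.\<close>
  have top: "t d - free_map ?R (t 0) \<in> ?N"
  proof -
    have "slotwise scale d ?s (Suc d) (\<lambda>xs. ?R (insert_z \<sigma> 0 xs))"
      by (intro slotwise_compose [OF slotwise_insert_z [OF vs hom]] slotwise_twisted_rotate
          module.module_hom_ident mod) auto
    then have "free_map (\<lambda>xs. ?R (insert_z \<sigma> 0 xs)) (p - free_map (map \<sigma>) p) \<in> ?N"
      using inv slotwise_tensor_null by fastforce
    moreover have "t d = free_map (\<lambda>xs. ?R (insert_z \<sigma> 0 xs)) (free_map (map \<sigma>) p)"
      unfolding t_def free_map_free_map
      using len by (intro free_map_cong twisted_rotate_insert_z_0) simp
    ultimately have "- (t d - free_map ?R (t 0)) \<in> ?N"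
      by (simp add: free_map_diff t_def free_map_free_map)
    then show ?thesis
      using free.subspace_neg [OF subspace_tensor_null] by fastforce
  qed
  \<comment> \<open>The term of index 0 is split off and the others are shifted down by one, which
    costs the minus sign.\<close>
  have "free_map ?R Q
      = free_map ?R (t 0) - (\<Sum>i<d. free_scale ((-1) ^ i) (free_map ?R (t (Suc i))))"
    unfolding Q_def atLeast0AtMost lessThan_Suc_atMost [symmetric] sum.lessThan_Suc_shift
    by (simp add: free_map_diff free_map_sum free_map_scale sum_negf)
  \<comment> \<open>Here the term of index d is split off, so that the remaining indices
    \<open>i < d\<close> pair with the shifted terms of the rotated sum and the two exceptional
    terms pair with each other.\<close>
  moreover have "Q = (\<Sum>i<d. free_scale ((-1) ^ i) (t i)) + free_scale ((-1) ^ d) (t d)"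
    unfolding Q_def atLeast0AtMost lessThan_Suc_atMost [symmetric] by simp
  ultimately have "Q - free_scale ((-1) ^ d) (free_map ?R Q)
      = (\<Sum>i<d. free_scale ((-1) ^ i) (t i - free_scale c (free_map ?R (t (Suc i)))))
        + free_scale ((-1) ^ d) (t d - free_map ?R (t 0))"
    by (simp add: c free.scale_right_diff_distrib free.scale_sum_right
        sum_subtractf sum_negf mult.commute)
  also have "\<dots> \<in> ?N"
    using lower top by (intro null) auto
  finally have "Q - free_scale ((-1) ^ d) (free_map ?R Q) \<in> ?N" .
  moreover have "length xs = d + 1" if xs: "xs \<in> Poly_Mapping.keys Q" for xs
  proof -
    obtain i where "xs \<in> Poly_Mapping.keys (free_scale ((-1) ^ i) (t i))"
      using subsetD [OF keys_sum xs [unfolded Q_def]] by blast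
    then have "xs \<in> insert_z \<sigma> i ` Poly_Mapping.keys p"
      unfolding t_def by (rule subsetD [OF subset_trans [OF keys_free_scale keys_free_map]])
    then show ?thesis
      using len by (auto simp: length_insert_z)
  qed
  ultimately show ?thesis
    unfolding superpotential_def w_hat
    \<comment> \<open>In degree d + 1 the required sign is \<open>(-1) ^ (d + 1 - 1)\<close>, that
      is \<open>(-1) ^ d\<close>.\<close>
    using twisted_superpotential_coset_iff [OF module.module_hom_ident [OF mod], of Q "d + 1"]
    by simp
qed

end
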